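(* Let $d\ge4$ be even. For the model $\mathcal{H}_{n,d}$, the smallest order of a supercritical tangle is $\tau_{\mathrm{fund}}=\lceil\sqrt{d-1}\rceil-1$.
   Context: $\mathcal{H}_{n,d}$: independent permutations $\pi_1,\dots,\pi_{d/2}$ of $\{1,\dots,n\}$, each uniform among those consisting of a single $n$-cycle; the graph has, for each $j,i$, a directed edge $i\to\pi_j(i)$ labelled $\pi_j$ paired with its reverse labelled $\pi_j^{-1}$. A tangle is a connected labelled graph that occurs (via a label-preserving homomorphism injective on vertices and edges) in some graph of $\mathcal{H}_{n,d}$ for some $n$. The order of a graph is (number of undirected edges) $-$ (number of vertices). For a graph $T$, $T_{\mathrm{irr}}$ is the directed graph on the directed edges of $T$ with $e_1\to e_2$ iff $e_1$ terminates at the origin of $e_2$ and $e_2$ is not the reverse of $e_1$; $\lambda_{\mathrm{irr}}(T)$ is the Perron–Frobenius eigenvalue of $T_{\mathrm{irr}}$. A tangle is supercritical if $\lambda_{\mathrm{irr}}\ge\sqrt{d-1}$.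
   Formalization: Tangles are required to occur in a graph of H_{n,d} with n ≥ 2; if n = 1 were allowed, the statement would fail, e.g. for d = 6 two loops at one vertex have λ_irr = 3 ≥ √5 and order 1 < 2. *)

theory Defs
  imports
    "HOL-Combinatorics.Combinatorics"
    "Graph_Theory.Graph_Theory"
    "Jordan_Normal_Form.Spectral_Radius"
begin

text \<open>
  The labels are \<open>Fwd j\<close>, standing for \<open>\<pi>\<^sub>j\<close>, and \<open>Bwd j\<close>, standing for the inverse of \<open>\<pi>\<^sub>j\<close>.
\<close>

datatype lab = Fwd nat | Bwd nat

fun inv_lab :: "lab \<Rightarrow> lab" where
  "inv_lab (Fwd j) = Bwd j"
| "inv_lab (Bwd j) = Fwd j"

text \<open>
  An undirected edge is a pair of mutually reverse arcs, so that multiple edges and loops are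
  allowed. The locale \<^locale>\<open>bidirected_digraph\<close> requires the reversal to be the identity outside
  the set of arcs and to have no fixed points on it (there are no half-loops).
\<close>

record ('v, 'e) lgraph =
  dgraph :: "('v, 'e) pre_digraph"
  rev_arc :: "'e \<Rightarrow> 'e"
  lab_of :: "'e \<Rightarrow> lab"

abbreviation V :: "('v, 'e) lgraph \<Rightarrow> 'v set" where
  "V T \<equiv> verts (dgraph T)"

abbreviation E :: "('v, 'e) lgraph \<Rightarrow> 'e set" where
  "E T \<equiv> arcs (dgraph T)"

abbreviation src :: "('v, 'e) lgraph \<Rightarrow> 'e \<Rightarrow> 'v" where
  "src T \<equiv> tail (dgraph T)"

abbreviation trg :: "('v, 'e) lgraph \<Rightarrow> 'e \<Rightarrow> 'v" where
  "trg T \<equiv> head (dgraph T)"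

definition labelled_graph :: "('v, 'e) lgraph \<Rightarrow> bool" where
  "labelled_graph T \<longleftrightarrow>
     fin_digraph (dgraph T) \<and> bidirected_digraph (dgraph T) (rev_arc T) \<and>
     (\<forall>e \<in> E T. lab_of T (rev_arc T e) = inv_lab (lab_of T e))"

definition edges :: "('v, 'e) lgraph \<Rightarrow> 'e set set" where
  "edges T = (\<lambda>e. {e, rev_arc T e}) ` E T"

definition graph_order :: "('v, 'e) lgraph \<Rightarrow> int" where
  "graph_order T = int (card (edges T)) - int (card (V T))"


definition full_cycle :: "nat \<Rightarrow> (nat \<Rightarrow> nat) \<Rightarrow> bool" where
  "full_cycle n p \<longleftrightarrow> p permutes {1..n} \<and> cyclic_on p {1..n}"

text \<open>
  The arc \<open>(Fwd j, i)\<close> is the directed edge from \<open>i\<close> to \<open>\<pi>\<^sub>j(i)\<close> labelled \<open>\<pi>\<^sub>j\<close>, and \<open>(Bwd j, i)\<close> is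
  the reverse of that same edge, running from \<open>\<pi>\<^sub>j(i)\<close> to \<open>i\<close>.
\<close>

definition perm_arcs :: "nat \<Rightarrow> nat \<Rightarrow> (lab \<times> nat) set" where
  "perm_arcs d n = (Fwd ` {1..d div 2} \<union> Bwd ` {1..d div 2}) \<times> {1..n}"

fun perm_tail :: "(nat \<Rightarrow> nat \<Rightarrow> nat) \<Rightarrow> lab \<times> nat \<Rightarrow> nat" where
  "perm_tail \<pi> (Fwd j, i) = i"
| "perm_tail \<pi> (Bwd j, i) = \<pi> j i"

fun perm_head :: "(nat \<Rightarrow> nat \<Rightarrow> nat) \<Rightarrow> lab \<times> nat \<Rightarrow> nat" where
  "perm_head \<pi> (Fwd j, i) = \<pi> j i"
| "perm_head \<pi> (Bwd j, i) = i"

definition perm_graph :: "nat \<Rightarrow> nat \<Rightarrow> (nat \<Rightarrow> nat \<Rightarrow> nat) \<Rightarrow> (nat, lab \<times> nat) lgraph" where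
  "perm_graph d n \<pi> =
     \<lparr> dgraph = \<lparr> verts = {1..n}, arcs = perm_arcs d n,
                  tail = perm_tail \<pi>, head = perm_head \<pi> \<rparr>,
       rev_arc = (\<lambda>e. if e \<in> perm_arcs d n then (inv_lab (fst e), snd e) else e),
       lab_of = fst \<rparr>"

text \<open>
  The graphs occurring in the model. Every choice of the \<open>\<pi>\<^sub>j\<close> has positive probability, so the
  notion of a tangle depends only on this set of outcomes.
\<close>

definition model_H :: "nat \<Rightarrow> nat \<Rightarrow> (nat, lab \<times> nat) lgraph set" where
  "model_H n d = {perm_graph d n \<pi> | \<pi>. \<forall>j \<in> {1..d div 2}. full_cycle n (\<pi> j)}"

lemma labelled_graph_model_H:
  assumes "G \<in> model_H n d"
  shows "labelled_graph G"
proof -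
  obtain \<pi> where G: "G = perm_graph d n \<pi>" and \<pi>: "\<forall>j \<in> {1..d div 2}. \<pi> j permutes {1..n}"
    using assms by (auto simp: model_H_def full_cycle_def)
  have *: "\<pi> j i \<in> {1..n}" if "j \<in> {1..d div 2}" "i \<in> {1..n}" for i j
    using permutes_in_image[of "\<pi> j" "{1..n}" i] \<pi> that by simp
  have "tail (dgraph G) e \<in> verts (dgraph G) \<and> head (dgraph G) e \<in> verts (dgraph G)"
    if "e \<in> arcs (dgraph G)" for e
  proof -
    obtain l i where e: "e = (l, i)"
      by (cases e)
    show ?thesis
      using that * by (cases l) (auto simp: G perm_graph_def perm_arcs_def e)
  qed
  then have wf: "wf_digraph (dgraph G)"
    by unfold_locales simp_all
  have "fin_digraph (dgraph G)"
    by (rule wf_digraph.fin_digraphI[OF wf]) (auto simp: G perm_graph_def perm_arcs_def)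
  moreover have "bidirected_digraph (dgraph G) (rev_arc G)"
    by (rule wf_digraph.bidirected_digraphI[OF wf])
       (auto simp: G perm_graph_def perm_arcs_def)
  ultimately show ?thesis
    by (auto simp: labelled_graph_def G perm_graph_def)
qed


definition occurs_in :: "('v, 'e) lgraph \<Rightarrow> ('w, 'f) lgraph \<Rightarrow> bool" where
  "occurs_in T G \<longleftrightarrow>
     (\<exists>f g. f ` V T \<subseteq> V G \<and> inj_on f (V T) \<and> g ` E T \<subseteq> E G \<and> inj_on g (E T) \<and>
        (\<forall>e \<in> E T. src G (g e) = f (src T e) \<and> trg G (g e) = f (trg T e) \<and>
           rev_arc G (g e) = g (rev_arc T e) \<and> lab_of G (g e) = lab_of T e))"

text \<open>
  The degenerate size \<open>n = 1\<close> is left out: the only permutation of a one-element set is a fixed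
  point, which would put loops into the model. For \<open>n \<ge> 2\<close> an \<open>n\<close>-cycle has no fixed points.
\<close>

definition tangle :: "nat \<Rightarrow> ('v, 'e) lgraph \<Rightarrow> bool" where
  "tangle d T \<longleftrightarrow>
     labelled_graph T \<and> Digraph_Component.connected (dgraph T) \<and>
     (\<exists>n \<ge> 2. \<exists>G \<in> model_H n d. occurs_in T G)"


definition irr :: "('v, 'e) lgraph \<Rightarrow> ('e, 'e \<times> 'e) pre_digraph" where
  "irr T = \<lparr> verts = E T,
             arcs = {(e1, e2). e1 \<in> E T \<and> e2 \<in> E T \<and> trg T e1 = src T e2 \<and> e2 \<noteq> rev_arc T e1},
             tail = fst, head = snd \<rparr>"

definition adj_mat :: "('v :: linorder, 'e) pre_digraph \<Rightarrow> complex mat" where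
  "adj_mat G =
     (let vs = sorted_list_of_set (verts G)
      in mat (length vs) (length vs)
           (\<lambda>(i, j). of_nat (card {a \<in> arcs G. tail G a = vs ! i \<and> head G a = vs ! j})))"

text \<open>
  The Perron--Frobenius eigenvalue of a finite digraph is that of its (entrywise non-negative)
  adjacency matrix: the non-negative eigenvalue of largest modulus, whose value is the spectral
  radius. The digraph without vertices has no eigenvalues and gets the value 0; this concerns
  \<^term>\<open>irr T\<close> when \<open>T\<close> is a single vertex.
\<close>

definition pf_eigenvalue :: "('v :: linorder, 'e) pre_digraph \<Rightarrow> real" where
  "pf_eigenvalue G = (if verts G = {} then 0 else spectral_radius (adj_mat G))"

definition lambda_irr :: "('v, 'e :: linorder) lgraph \<Rightarrow> real" where
  "lambda_irr T = pf_eigenvalue (irr T)"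

definition supercritical :: "nat \<Rightarrow> ('v, 'e :: linorder) lgraph \<Rightarrow> bool" where
  "supercritical d T \<longleftrightarrow> lambda_irr T \<ge> sqrt (real d - 1)"

text \<open>
  Tangles are finite, so up to isomorphism their vertices and arcs may be taken to be natural
  numbers.
\<close>

definition supercritical_tangles :: "nat \<Rightarrow> (nat, nat) lgraph set" where
  "supercritical_tangles d = {T. tangle d T \<and> supercritical d T}"

end

theory Submission
  imports Defs
begin

text \<open>
  A tangle has no loops, and for a connected loopless graph of order \<open>r\<close> the eigenvalues \<open>c\<close> of
  \<open>T\<^sub>i\<^sub>r\<^sub>r\<close> satisfy \<open>\<bar>c\<bar> \<le> r + 1\<close>. Indeed, an eigenfunction for \<open>c \<noteq> 0\<close> stays one after leaves are
  pruned, which does not increase the order beyond \<open>r\<close> and leaves a graph of minimum degree two. There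
  every arc has at most \<open>(r + 1)\<^sup>2\<close> non-backtracking continuations of length two; evaluating
  the square of the operator at an arc where the eigenfunction is largest gives \<open>\<bar>c\<bar>\<^sup>2 \<le> (r + 1)\<^sup>2\<close>.
  Conversely, \<open>m\<close> parallel edges between two vertices have order \<open>m - 2\<close> and eigenvalue \<open>m - 1\<close>.
\<close>

section \<open>Non-backtracking walks on a finite graph with paired arcs\<close>

locale fin_bidirected_digraph = fin_digraph G + bidirected_digraph G arev for G arev
begin

text \<open>For \<open>H = arcs G\<close> these are the successors of \<open>e\<close> in
  \<open>irr\<close>. A variable arc set \<open>H\<close> inside a fixed \<open>G\<close> allows
  pruning without forming new digraphs.\<close>

definition nb_succ :: "'b set \<Rightarrow> 'b \<Rightarrow> 'b set" where
  "nb_succ H e = {f \<in> H. tail G f = head G e \<and> f \<noteq> arev e}"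

definition outdeg :: "'b set \<Rightarrow> 'a \<Rightarrow> nat" where
  "outdeg H v = card {f \<in> H. tail G f = v}"

text \<open>Connectedness refers to the symmetric closure. As arcs come with their reverses, it
  gives a directed path from \<open>S\<close> to its complement, and some arc of it leaves
  \<open>S\<close>.\<close>

lemma connected_crossing_arc:
  assumes "Digraph_Component.connected G" "S \<subseteq> verts G" "S \<noteq> {}" "S \<noteq> verts G"
  obtains e where "e \<in> arcs G" "tail G e \<in> S" "head G e \<notin> S"
proof -
  obtain u v where u: "u \<in> S" and v: "v \<in> verts G" "v \<notin> S"
    using assms by blast
  then have "u \<rightarrow>\<^sup>*\<^bsub>with_proj (mk_symmetric G)\<^esub> v"
    using assms by (auto simp: connected_def strongly_connected_def)
  then have reach: "u \<rightarrow>\<^sup>*\<^bsub>G\<^esub> v"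
    using reachable_mk_symmetric_eq[OF sym_arcs] by simp
  show ?thesis
  proof (rule ccontr)
    assume *: "\<not> thesis"
    from reach have "v \<in> S"
    proof (induction rule: reachable_induct)
      case base
      show ?case by (rule u)
    next
      case (step y z)
      then obtain a where "a \<in> arcs G" "tail G a = y" "head G a = z"
        by (auto simp: arcs_ends_def arc_to_ends_def)
      with step.IH * that show ?case by blast
    qed
    with v show False by blast
  qed
qed

text \<open>
  Growing \<open>S\<close> along arcs that leave it adds two arcs per new vertex.
\<close>

lemma connected_excess_mono:
  assumes conn: "Digraph_Component.connected G"
    and "H \<subseteq> arcs G" "arev ` H \<subseteq> H" "S \<subseteq> verts G" "S \<noteq> {}" "tail G ` H \<subseteq> S"
  shows "int (card H) - 2 * int (card S) \<le> int (card (arcs G)) - 2 * int (card (verts G))"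
  using assms(2-)
proof (induction "card (verts G - S)" arbitrary: H S)
  case 0
  then have "S = verts G"
    by auto
  moreover have "card H \<le> card (arcs G)"
    using 0 by (intro card_mono) auto
  ultimately show ?case
    by simp
next
  case (Suc k)
  from Suc.hyps(2) have "S \<noteq> verts G"
    by auto
  then obtain e where e: "e \<in> arcs G" "tail G e \<in> S" "head G e \<notin> S"
    using connected_crossing_arc[OF conn] Suc.prems by metis
  have fin: "finite H" "finite S"
    using Suc.prems finite_subset[OF _ finite_arcs] finite_subset[OF _ finite_verts] by auto
  \<comment> \<open>All tails in \<open>H\<close> lie in \<open>S\<close>, while
    \<open>arev e\<close> starts outside; as \<open>H\<close> is closed under reversal, it contains
    neither arc.\<close>
  have new: "e \<notin> H" "arev e \<notin> H" "e \<noteq> arev e"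
    using e Suc.prems arev_neq[of e] by (auto simp: image_subset_iff) (metis tail_arev)+
  have "verts G - insert (head G e) S = (verts G - S) - {head G e}"
    by blast
  then have "k = card (verts G - insert (head G e) S)"
    using Suc.hyps(2) e by simp
  then have "int (card (insert e (insert (arev e) H))) - 2 * int (card (insert (head G e) S))
      \<le> int (card (arcs G)) - 2 * int (card (verts G))"
    by (rule Suc.hyps(1)) (use Suc.prems e in auto)
  then show ?case
    using new e fin by simp
qed

lemma sum_outdeg:
  assumes "H \<subseteq> arcs G"
  shows "(\<Sum>v\<in>tail G ` H. outdeg H v) = card H"
proof -
  have "finite H"
    using assms finite_subset finite_arcs by blast
  then show ?thesis
    using sum.image_gen[of H "\<lambda>_. 1::nat" "tail G"] by (simp add: outdeg_def)
qed

lemma card_nb_succ: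
  assumes "H \<subseteq> arcs G" "arev ` H \<subseteq> H" "e \<in> H"
  shows "card (nb_succ H e) + 1 = outdeg H (head G e)"
proof -
  have fin: "finite H"
    using assms finite_subset finite_arcs by blast
  have "{f \<in> H. tail G f = head G e} = insert (arev e) (nb_succ H e)"
    using assms by (auto simp: nb_succ_def)
  then show ?thesis
    using fin by (simp add: outdeg_def nb_succ_def)
qed

text \<open>
  If \<open>D\<close> is the degree of the head of \<open>e\<close>, there are \<open>D - 1\<close> ways to continue \<open>e\<close>, and each of
  them ends at another vertex since there are no loops. All degrees being at least two, the
  excess (degree minus two) of that other vertex is at most \<open>2 r - (D - 2)\<close>, so that the number of
  continuations by two arcs is at most \<open>(D - 1) (2 r + 3 - D)\<close>, which is largest for \<open>D = r + 2\<close>.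
\<close>

lemma two_step_bound:
  assumes H: "H \<subseteq> arcs G" "arev ` H \<subseteq> H"
    and noloop: "\<And>e. e \<in> H \<Longrightarrow> tail G e \<noteq> head G e"
    and deg: "\<And>v. v \<in> tail G ` H \<Longrightarrow> outdeg H v \<ge> 2"
    and excess: "int (card H) - 2 * int (card (tail G ` H)) \<le> 2 * r"
    and e: "e \<in> H"
  shows "int (\<Sum>f\<in>nb_succ H e. card (nb_succ H f)) \<le> (r + 1)\<^sup>2"
proof -
  have finH: "finite H"
    using H finite_subset finite_arcs by blast
  have head: "head G f \<in> tail G ` H" if "f \<in> H" for f
    using that H by (metis image_eqI image_subset_iff subsetD tail_arev)
  define D where "D = int (outdeg H (head G e))"
  have "(\<Sum>v\<in>tail G ` H. int (outdeg H v) - 2) = int (card H) - 2 * int (card (tail G ` H))"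
    using sum_outdeg[OF H(1)] by (simp add: sum_subtractf flip: of_nat_sum)
  with excess have total: "(\<Sum>v\<in>tail G ` H. int (outdeg H v) - 2) \<le> 2 * r"
    by simp
  have step: "int (card (nb_succ H f)) \<le> 2 * r + 3 - D" if f: "f \<in> nb_succ H e" for f
  proof -
    have fH: "f \<in> H" "tail G f = head G e"
      using f by (auto simp: nb_succ_def)
    then have ne: "head G f \<noteq> head G e"
      using noloop by metis
    have "(\<Sum>v\<in>{head G e, head G f}. int (outdeg H v) - 2)
        \<le> (\<Sum>v\<in>tail G ` H. int (outdeg H v) - 2)"
      using head e fH finH deg by (intro sum_mono2) fastforce+
    also note total
    finally have "int (outdeg H (head G f)) + D - 4 \<le> 2 * r"
      using ne by (simp add: D_def)
    then show ?thesis
      using card_nb_succ[OF H fH(1)] by simp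
  qed
  have "int (\<Sum>f\<in>nb_succ H e. card (nb_succ H f)) \<le> (\<Sum>f\<in>nb_succ H e. 2 * r + 3 - D)"
    unfolding of_nat_sum by (intro sum_mono step)
  also have "\<dots> = (D - 1) * (2 * r + 3 - D)"
    using card_nb_succ[OF H e] by (simp add: D_def flip: of_nat_Suc)
  also have "\<dots> = (r + 1)\<^sup>2 - (r + 2 - D)\<^sup>2"
    by (simp add: power2_eq_square algebra_simps)
  also have "\<dots> \<le> (r + 1)\<^sup>2"
    by simp
  finally show ?thesis .
qed

section \<open>Eigenfunctions and pruning to minimum degree two\<close>

definition nb_eigenfunction :: "'b set \<Rightarrow> ('b \<Rightarrow> complex) \<Rightarrow> complex \<Rightarrow> bool" where
  "nb_eigenfunction H x c \<longleftrightarrow>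
     (\<exists>e\<in>H. x e \<noteq> 0) \<and> (\<forall>e\<in>H. (\<Sum>f\<in>nb_succ H e. x f) = c * x e)"

text \<open>
  An eigenfunction for a nonzero eigenvalue vanishes on an arc into a leaf, so that the
  edge at the leaf can be deleted.
\<close>

lemma nb_eigenfunction_delete_leaf:
  assumes H: "H \<subseteq> arcs G" "arev ` H \<subseteq> H"
    and x: "nb_eigenfunction H x c" and c: "c \<noteq> 0"
    and f: "f \<in> H" and leaf: "outdeg H (tail G f) < 2"
  shows "nb_eigenfunction (H - {f, arev f}) x c"
proof -
  have finH: "finite H"
    using H finite_subset finite_arcs by blast
  have revf: "arev f \<in> H"
    using H f by blast
  have fG: "f \<in> arcs G"
    using H f by blast
  have "card (nb_succ H (arev f)) = 0"
    using card_nb_succ[OF H revf] leaf fG by simp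
  then have "nb_succ H (arev f) = {}"
    using finH by (simp add: nb_succ_def)
  then have only: "g = f" if "g \<in> H" "tail G g = tail G f" for g
    using that fG by (auto simp: nb_succ_def)
  have "(\<Sum>g\<in>nb_succ H (arev f). x g) = c * x (arev f)"
    using x revf by (simp add: nb_eigenfunction_def)
  then have x0: "x (arev f) = 0"
    using c \<open>nb_succ H (arev f) = {}\<close> by simp
  define H' where "H' = H - {f, arev f}"
  \<comment> \<open>Deletion keeps these sums: \<open>f\<close> continues no other arc, being alone
    at the leaf, and \<open>arev f\<close> only contributes a zero.\<close>
  have sum_eq: "(\<Sum>g\<in>nb_succ H' e. x g) = (\<Sum>g\<in>nb_succ H e. x g)" if e: "e \<in> H" "e \<noteq> arev f" for e
  proof (rule sum.mono_neutral_left)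
    show "finite (nb_succ H e)" "nb_succ H' e \<subseteq> nb_succ H e"
      using finH by (auto simp: nb_succ_def H'_def)
    have "f \<notin> nb_succ H e"
    proof
      assume "f \<in> nb_succ H e"
      then have "tail G (arev e) = tail G f" "arev e \<in> H" "f \<noteq> arev e"
        using e H by (auto simp: nb_succ_def)
      with only show False by blast
    qed
    then show "\<forall>g\<in>nb_succ H e - nb_succ H' e. x g = 0"
      using x0 by (auto simp: nb_succ_def H'_def)
  qed
  have eig: "(\<Sum>g\<in>nb_succ H' e. x g) = c * x e" if "e \<in> H" "e \<noteq> arev f" for e
    using sum_eq[OF that] x that by (simp add: nb_eigenfunction_def)
  \<comment> \<open>If \<open>x\<close> vanished on \<open>H'\<close>, the equation at
    \<open>f\<close> would force \<open>x f = 0\<close>, since \<open>c\<close> is nonzero, and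
    \<open>x\<close> would vanish on \<open>H\<close>.\<close>
  have "\<exists>e\<in>H'. x e \<noteq> 0"
  proof (rule ccontr)
    assume "\<not> ?thesis"
    then have zero: "x e = 0" if "e \<in> H'" for e
      using that by blast
    then have "(\<Sum>g\<in>nb_succ H' f. x g) = 0"
      by (intro sum.neutral) (auto simp: nb_succ_def)
    then have "x f = 0"
      using eig[OF f] c arev_neq[OF fG] by simp
    then have "\<forall>e\<in>H. x e = 0"
      using zero x0 by (auto simp: H'_def)
    with x show False
      by (simp add: nb_eigenfunction_def)
  qed
  with eig show ?thesis
    unfolding nb_eigenfunction_def H'_def[symmetric] by (auto simp: H'_def)
qed

text \<open>A reversal-closed arc set of least size that carries the eigenfunction has no leaf, for
  deleting one would give a smaller such set.\<close>

lemma nb_eigenfunction_restrict_to_core: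
  assumes "nb_eigenfunction (arcs G) x c" "c \<noteq> 0"
  obtains H where "H \<subseteq> arcs G" "arev ` H \<subseteq> H" "nb_eigenfunction H x c"
    "\<And>v. v \<in> tail G ` H \<Longrightarrow> outdeg H v \<ge> 2"
proof -
  define P where "P H \<longleftrightarrow> H \<subseteq> arcs G \<and> arev ` H \<subseteq> H \<and> nb_eigenfunction H x c" for H
  have "P (arcs G)"
    using assms by (auto simp: P_def)
  then obtain H where H: "P H" and least: "\<And>H'. P H' \<Longrightarrow> card H \<le> card H'"
    by (rule exE[OF ex_has_least_nat[of P _ card]]) blast
  have finH: "finite H"
    using H finite_subset finite_arcs unfolding P_def by blast
  have "outdeg H (tail G f) \<ge> 2" if f: "f \<in> H" for f
  proof (rule ccontr)
    assume "\<not> ?thesis"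
    then have "nb_eigenfunction (H - {f, arev f}) x c"
      using H f assms(2) by (intro nb_eigenfunction_delete_leaf) (auto simp: P_def)
    then have "P (H - {f, arev f})"
      using H by (auto simp: P_def arev_eq_iff)
    then have "card H \<le> card (H - {f, arev f})"
      by (rule least)
    moreover have "card (H - {f, arev f}) < card H"
      using finH f by (intro psubset_card_mono) auto
    ultimately show False by simp
  qed
  with H that show ?thesis
    unfolding P_def by blast
qed

text \<open>With two arcs per edge, \<open>r\<close> is the order. Although pruning removes arcs and
  vertices, \<open>connected_excess_mono\<close> keeps the excess of the core at most that of
  \<open>G\<close>.\<close>

lemma norm_nb_eigenvalue_le:
  assumes conn: "Digraph_Component.connected G"
    and noloop: "\<And>e. e \<in> arcs G \<Longrightarrow> tail G e \<noteq> head G e"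
    and x: "nb_eigenfunction (arcs G) x c" and c: "c \<noteq> 0"
    and r: "int (card (arcs G)) - 2 * int (card (verts G)) = 2 * r"
  shows "norm c \<le> of_int (r + 1)"
proof -
  obtain H where H: "H \<subseteq> arcs G" "arev ` H \<subseteq> H" and eig: "nb_eigenfunction H x c"
    and deg: "\<And>v. v \<in> tail G ` H \<Longrightarrow> outdeg H v \<ge> 2"
    using nb_eigenfunction_restrict_to_core[OF x c] by metis
  have finH: "finite H"
    using H finite_subset finite_arcs by blast
  have neH: "H \<noteq> {}"
    using eig by (auto simp: nb_eigenfunction_def)
  have excess: "int (card H) - 2 * int (card (tail G ` H)) \<le> 2 * r"
    unfolding r[symmetric] using H neH by (intro connected_excess_mono[OF conn]) auto
  \<comment> \<open>Degrees of at least two make the excess nonnegative, so \<open>r + 1\<close> is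
    nonnegative when squares are compared at the end.\<close>
  have "(\<Sum>v\<in>tail G ` H. 2) \<le> (\<Sum>v\<in>tail G ` H. outdeg H v)"
    by (intro sum_mono deg)
  then have r0: "r \<ge> 0"
    using sum_outdeg[OF H(1)] excess by simp
  define M where "M = Max ((\<lambda>e. norm (x e)) ` H)"
  have "M \<in> (\<lambda>e. norm (x e)) ` H"
    unfolding M_def using finH neH by (intro Max_in) auto
  then obtain e where e: "e \<in> H" "norm (x e) = M"
    by auto
  have le_M: "norm (x f) \<le> M" if "f \<in> H" for f
    unfolding M_def using finH that by (intro Max_ge) auto
  have M: "M > 0"
    using eig le_M by (auto simp: nb_eigenfunction_def) (metis norm_le_zero_iff not_less order_trans)
  have sub: "nb_succ H f \<subseteq> H" for f
    by (auto simp: nb_succ_def)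
  \<comment> \<open>Two steps are taken because the excess bound alone would allow up to
    \<open>2 * r + 1\<close> continuations of a single arc.\<close>
  have "c\<^sup>2 * x e = (\<Sum>f\<in>nb_succ H e. c * x f)"
    using eig e by (simp add: nb_eigenfunction_def power2_eq_square mult.assoc flip: sum_distrib_left)
  also have "\<dots> = (\<Sum>f\<in>nb_succ H e. \<Sum>g\<in>nb_succ H f. x g)"
    using eig by (intro sum.cong) (auto simp: nb_eigenfunction_def dest: subsetD[OF sub])
  finally have "(norm c)\<^sup>2 * M = norm (\<Sum>f\<in>nb_succ H e. \<Sum>g\<in>nb_succ H f. x g)"
    using e(2) by (metis norm_mult norm_power)
  also have "\<dots> \<le> (\<Sum>f\<in>nb_succ H e. \<Sum>g\<in>nb_succ H f. M)"
    using sub le_M by (intro sum_norm_le) blast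
  also have "\<dots> = real_of_int (int (\<Sum>f\<in>nb_succ H e. card (nb_succ H f))) * M"
    by (simp add: sum_distrib_right)
  also have "\<dots> \<le> real_of_int ((r + 1)\<^sup>2) * M"
    using two_step_bound[OF H _ deg excess e(1)] noloop H M
    by (intro mult_right_mono of_int_le_iff[THEN iffD2]) auto
  finally have "(norm c)\<^sup>2 \<le> (real_of_int (r + 1))\<^sup>2"
    using M by simp
  then show ?thesis
    by (rule power2_le_imp_le) (use r0 in simp)
qed

end

section \<open>The adjacency matrix of \<open>irr T\<close> and its spectrum\<close>

lemma fin_bidirected_digraph_if_labelled_graph:
  "labelled_graph T \<Longrightarrow> fin_bidirected_digraph (dgraph T) (rev_arc T)"
  by (simp add: labelled_graph_def fin_bidirected_digraph_def)

text \<open>The sets \<open>{e, rev_arc T e}\<close> partition the arcs, and each has two elements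
  because reversal fixes no arc.\<close>

lemma card_arcs_eq_twice_card_edges:
  assumes "labelled_graph T"
  shows "card (E T) = 2 * card (edges T)"
proof -
  interpret fin_bidirected_digraph "dgraph T" "rev_arc T"
    using assms by (rule fin_bidirected_digraph_if_labelled_graph)
  have "card (\<Union>(edges T)) = (\<Sum>A\<in>edges T. card A)"
    by (rule card_Union_disjoint)
       (auto simp: edges_def pairwise_def disjnt_def arev_eq_iff)
  also have "\<dots> = (\<Sum>A\<in>edges T. 2)"
    by (rule sum.cong) (auto simp: edges_def card_insert_if dest: arev_neq)
  also have "\<Union>(edges T) = E T"
    by (auto simp: edges_def)
  finally show ?thesis
    by simp
qed

lemma verts_irr [simp]: "verts (irr T) = E T"
  by (simp add: irr_def)

text \<open>Arcs of \<open>irr T\<close> are pairs of arcs of \<open>T\<close>, so no two are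
  parallel and every entry is 0 or 1.\<close>

lemma index_adj_mat_irr:
  fixes T :: "('v, 'e :: linorder) lgraph"
  assumes "labelled_graph T" "i < card (E T)" "j < card (E T)"
  defines "es \<equiv> sorted_list_of_set (E T)"
  shows "adj_mat (irr T) $$ (i, j) =
    of_bool (es ! j \<in> fin_bidirected_digraph.nb_succ (dgraph T) (rev_arc T) (E T) (es ! i))"
proof -
  interpret fin_bidirected_digraph "dgraph T" "rev_arc T"
    using assms by (simp add: fin_bidirected_digraph_if_labelled_graph)
  have len: "length es = card (E T)"
    by (simp add: es_def)
  have mem: "es ! i \<in> E T" "es ! j \<in> E T"
    using assms len nth_mem[of _ es] by (auto simp: es_def)
  have "{a \<in> arcs (irr T). tail (irr T) a = es ! i \<and> head (irr T) a = es ! j} =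
      (if es ! j \<in> nb_succ (E T) (es ! i) then {(es ! i, es ! j)} else {})"
    using mem by (auto simp: irr_def nb_succ_def)
  then have "card {a \<in> arcs (irr T). tail (irr T) a = es ! i \<and> head (irr T) a = es ! j} =
      of_bool (es ! j \<in> nb_succ (E T) (es ! i))"
    by simp
  then show ?thesis
    using assms len by (simp add: adj_mat_def Let_def verts_irr)
qed

lemma adj_mat_irr_carrier:
  "adj_mat (irr T) \<in> carrier_mat (card (E T)) (card (E T))"
  by (simp add: adj_mat_def irr_def Let_def)

text \<open>Rows are indexed by the tail, so applying the matrix to a column vector sums over
  continuations, as in \<open>nb_eigenfunction\<close>.\<close>

lemma adj_mat_irr_mult_vec:
  fixes T :: "('v, 'e :: linorder) lgraph"
  assumes T: "labelled_graph T" and i: "i < card (E T)"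
  defines "es \<equiv> sorted_list_of_set (E T)"
  shows "(adj_mat (irr T) *\<^sub>v vec (card (E T)) (\<lambda>j. x (es ! j))) $ i =
    (\<Sum>f\<in>fin_bidirected_digraph.nb_succ (dgraph T) (rev_arc T) (E T) (es ! i). x f)"
proof -
  interpret fin_bidirected_digraph "dgraph T" "rev_arc T"
    using T by (rule fin_bidirected_digraph_if_labelled_graph)
  define N where "N = nb_succ (E T) (es ! i)"
  have bij: "bij_betw ((!) es) {0..<card (E T)} (E T)"
    by (rule bij_betw_nth) (auto simp: es_def)
  have "(adj_mat (irr T) *\<^sub>v vec (card (E T)) (\<lambda>j. x (es ! j))) $ i =
      (\<Sum>j\<in>{0..<card (E T)}. adj_mat (irr T) $$ (i, j) * x (es ! j))"
    using adj_mat_irr_carrier[of T] i by (simp add: scalar_prod_def)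
  also have "\<dots> = (\<Sum>j\<in>{0..<card (E T)}. if es ! j \<in> N then x (es ! j) else 0)"
    using i by (intro sum.cong) (auto simp: index_adj_mat_irr[OF T] N_def es_def)
  also have "\<dots> = (\<Sum>f\<in>E T. if f \<in> N then x f else 0)"
    by (rule sum.reindex_bij_betw[OF bij, of "\<lambda>f. if f \<in> N then x f else 0"])
  also have "\<dots> = (\<Sum>f\<in>E T \<inter> N. x f)"
    by (simp add: sum.inter_restrict)
  also have "E T \<inter> N = N"
    by (auto simp: N_def nb_succ_def)
  finally show ?thesis
    by (simp add: N_def)
qed

lemma eigenvalue_adj_mat_irr_iff:
  fixes T :: "('v, 'e :: linorder) lgraph"
  assumes T: "labelled_graph T"
  shows "eigenvalue (adj_mat (irr T)) c \<longleftrightarrow>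
    (\<exists>x. fin_bidirected_digraph.nb_eigenfunction (dgraph T) (rev_arc T) (E T) x c)"
proof -
  interpret fin_bidirected_digraph "dgraph T" "rev_arc T"
    using T by (rule fin_bidirected_digraph_if_labelled_graph)
  define es where "es = sorted_list_of_set (E T)"
  define n where "n = card (E T)"
  have bij: "bij_betw ((!) es) {..<n} (E T)"
    by (rule bij_betw_nth) (auto simp: es_def n_def)
  have E: "E T = (!) es ` {..<n}"
    using bij by (simp add: bij_betw_def)
  have dim: "dim_row (adj_mat (irr T)) = n" "dim_col (adj_mat (irr T)) = n"
    using adj_mat_irr_carrier[of T] by (auto simp: n_def)
  have key: "eigenvector (adj_mat (irr T)) (vec n (\<lambda>j. x (es ! j))) c
      \<longleftrightarrow> nb_eigenfunction (E T) x c" for x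
  proof -
    have "vec n (\<lambda>j. x (es ! j)) \<noteq> 0\<^sub>v n \<longleftrightarrow> (\<exists>e\<in>E T. x e \<noteq> 0)"
      by (auto simp: E vec_eq_iff)
    moreover have "adj_mat (irr T) *\<^sub>v vec n (\<lambda>j. x (es ! j)) = c \<cdot>\<^sub>v vec n (\<lambda>j. x (es ! j))
      \<longleftrightarrow> (\<forall>i<n. (\<Sum>f\<in>nb_succ (E T) (es ! i). x f) = c * x (es ! i))"
      using adj_mat_irr_mult_vec[OF T, of _ x]
      by (auto simp: vec_eq_iff dim n_def es_def simp del: index_mult_mat_vec)
    moreover have "(\<forall>i<n. (\<Sum>f\<in>nb_succ (E T) (es ! i). x f) = c * x (es ! i))
      \<longleftrightarrow> (\<forall>e\<in>E T. (\<Sum>f\<in>nb_succ (E T) e. x f) = c * x e)"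
      using E by auto
    ultimately show ?thesis
      by (simp add: eigenvector_def nb_eigenfunction_def dim)
  qed
  show ?thesis
  proof
    assume "eigenvalue (adj_mat (irr T)) c"
    then obtain v where v: "eigenvector (adj_mat (irr T)) v c"
      by (auto simp: eigenvalue_def)
    define x where "x e = v $ (the_inv_into {..<n} ((!) es) e)" for e
    have "v = vec n (\<lambda>j. x (es ! j))"
      using v bij by (intro eq_vecI)
        (auto simp: eigenvector_def dim x_def bij_betw_def the_inv_into_f_f)
    with v key show "\<exists>x. nb_eigenfunction (E T) x c"
      by metis
  qed (use key in \<open>auto simp: eigenvalue_def\<close>)
qed

text \<open>Attainment serves the bound for arbitrary tangles, maximality the one for the witness.
  Nonemptiness of \<open>E T\<close> excludes the default value 0 of
  \<open>pf_eigenvalue\<close>.\<close>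

lemma spectral_radius_adj_mat_irr:
  fixes T :: "('v, 'e :: linorder) lgraph"
  assumes T: "labelled_graph T" and ne: "E T \<noteq> {}"
  shows lambda_irr_eigenvalue: "\<exists>c. eigenvalue (adj_mat (irr T)) c \<and> norm c = lambda_irr T"
    and norm_eigenvalue_le_lambda_irr: "eigenvalue (adj_mat (irr T)) c \<Longrightarrow> norm c \<le> lambda_irr T"
proof -
  interpret fin_bidirected_digraph "dgraph T" "rev_arc T"
    using T by (rule fin_bidirected_digraph_if_labelled_graph)
  have lam: "lambda_irr T = spectral_radius (adj_mat (irr T))"
    using ne by (simp add: lambda_irr_def pf_eigenvalue_def irr_def)
  have "card (E T) > 0"
    using ne by (simp add: card_gt_0_iff)
  note mem_max = spectral_radius_mem_max[OF adj_mat_irr_carrier[of T] this]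
  show "\<exists>c. eigenvalue (adj_mat (irr T)) c \<and> norm c = lambda_irr T"
    using mem_max(1) by (auto simp: lam spectrum_def)
  show "norm c \<le> lambda_irr T" if "eigenvalue (adj_mat (irr T)) c"
    using mem_max(2)[of "norm c"] that by (auto simp: lam spectrum_def)
qed

section \<open>Absence of loops in tangles and the upper bound\<close>

lemma full_cycle_no_fixpoint:
  assumes "full_cycle n p" "n \<ge> 2" "i \<in> {1..n}"
  shows "p i \<noteq> i"
proof
  assume fixed: "p i = i"
  have "orbit p i = {1..n}"
    using assms by (auto simp: full_cycle_def cyclic_on_alldef)
  moreover have "orbit p i \<subseteq> {i}"
  proof
    fix y assume "y \<in> orbit p i"
    then show "y \<in> {i}"
      by induction (use fixed in auto)
  qed
  ultimately have "{1, 2} \<subseteq> {i}"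
    using assms(2) by auto
  then show False by auto
qed

text \<open>An occurrence carries a loop to a loop of the permutation graph, which would be a fixed
  point of some full cycle.\<close>

lemma tangle_no_loops:
  assumes "tangle d T" "e \<in> E T"
  shows "src T e \<noteq> trg T e"
proof
  assume loop: "src T e = trg T e"
  obtain n \<pi> where n: "n \<ge> 2" and \<pi>: "\<forall>j\<in>{1..d div 2}. full_cycle n (\<pi> j)"
    and occ: "occurs_in T (perm_graph d n \<pi>)"
    using assms by (auto simp: tangle_def model_H_def)
  obtain a where "a \<in> E (perm_graph d n \<pi>)"
    "src (perm_graph d n \<pi>) a = trg (perm_graph d n \<pi>) a"
    using occ assms(2) loop unfolding occurs_in_def by (metis image_subset_iff)
  then obtain j i where "j \<in> {1..d div 2}" "i \<in> {1..n}" "\<pi> j i = i"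
    by (auto simp: perm_graph_def perm_arcs_def)
  then show False
    using full_cycle_no_fixpoint \<pi> n by blast
qed

text \<open>Positivity rules out an arcless graph and makes the eigenvalue of modulus
  \<open>lambda_irr T\<close> nonzero, as pruning requires.\<close>

lemma lambda_irr_le_order:
  fixes T :: "('v, 'e :: linorder) lgraph"
  assumes T: "tangle d T" and pos: "lambda_irr T > 0"
  shows "lambda_irr T \<le> of_int (graph_order T + 1)"
proof -
  have lg: "labelled_graph T" and conn: "Digraph_Component.connected (dgraph T)"
    using T by (auto simp: tangle_def)
  interpret fin_bidirected_digraph "dgraph T" "rev_arc T"
    using lg by (rule fin_bidirected_digraph_if_labelled_graph)
  have "E T \<noteq> {}"
    using pos by (auto simp: lambda_irr_def pf_eigenvalue_def irr_def)
  then obtain c where c: "eigenvalue (adj_mat (irr T)) c" "norm c = lambda_irr T"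
    using lambda_irr_eigenvalue[OF lg] by blast
  then obtain x where "nb_eigenfunction (E T) x c"
    using eigenvalue_adj_mat_irr_iff[OF lg] by blast
  then have "norm c \<le> of_int (graph_order T + 1)"
    using tangle_no_loops[OF T] c pos card_arcs_eq_twice_card_edges[OF lg]
    by (intro norm_nb_eigenvalue_le[OF conn]) (auto simp: graph_order_def)
  with c show ?thesis
    by simp
qed

section \<open>The dipole as witness\<close>

text \<open>
  The witness: \<open>m\<close> parallel edges between the vertices 1 and 2 inside the graph with \<open>n = 2\<close>. Edge
  number \<open>t\<close> consists of the arcs \<open>2 t\<close> and \<open>2 t + 1\<close>; it is the edge leaving the vertex
  \<open>t mod 2 + 1\<close> along the permutation number \<open>t div 2 + 1\<close>.
\<close>

definition dipole_tail :: "nat \<Rightarrow> nat" where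
  "dipole_tail a = (if even a = even (a div 2) then 1 else 2)"

definition dipole :: "nat \<Rightarrow> (nat, nat) lgraph" where
  "dipole m =
     \<lparr> dgraph = \<lparr> verts = {1, 2}, arcs = {..<2 * m},
                  tail = dipole_tail, head = (\<lambda>a. 3 - dipole_tail a) \<rparr>,
       rev_arc = (\<lambda>a. if a < 2 * m then (if even a then a + 1 else a - 1) else a),
       lab_of = (\<lambda>a. (if even a then Fwd else Bwd) (a div 4 + 1)) \<rparr>"

lemma labelled_graph_dipole: "labelled_graph (dipole m)"
proof -
  have wf: "wf_digraph (dgraph (dipole m))"
    by unfold_locales (auto simp: dipole_def dipole_tail_def)
  have "fin_digraph (dgraph (dipole m))"
    by (rule wf_digraph.fin_digraphI[OF wf]) (auto simp: dipole_def)
  moreover have "bidirected_digraph (dgraph (dipole m)) (rev_arc (dipole m))"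
    by (rule wf_digraph.bidirected_digraphI[OF wf])
       (auto simp: dipole_def dipole_tail_def elim!: evenE oddE, presburger)
  moreover have "\<forall>e \<in> E (dipole m). lab_of (dipole m) (rev_arc (dipole m) e) = inv_lab (lab_of (dipole m) e)"
    by (auto simp: dipole_def elim!: evenE oddE; presburger)
  ultimately show ?thesis
    by (simp add: labelled_graph_def)
qed

lemma connected_dipole:
  assumes "m \<ge> 1"
  shows "Digraph_Component.connected (dgraph (dipole m))"
proof -
  interpret fin_bidirected_digraph "dgraph (dipole m)" "rev_arc (dipole m)"
    using labelled_graph_dipole by (rule fin_bidirected_digraph_if_labelled_graph)
  have ends: "(dipole_tail a, 3 - dipole_tail a) \<in> arcs_ends (dgraph (dipole m))" if "a < 2 * m" for a
    using that by (auto simp: arcs_ends_def arc_to_ends_def dipole_def)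
  have "u \<rightarrow>\<^sup>*\<^bsub>dgraph (dipole m)\<^esub> v" if "u \<in> {1, 2}" "v \<in> {1, 2}" for u v
  proof (cases "u = v")
    case True
    moreover have "v \<in> V (dipole m)"
      using that by (simp add: dipole_def)
    ultimately show ?thesis
      by simp
  next
    case False
    with that ends[of 0] ends[of 1] assms have "(u, v) \<in> arcs_ends (dgraph (dipole m))"
      by (auto simp: dipole_tail_def)
    then show ?thesis
      by (rule reachable_adjI)
  qed
  then show ?thesis
    unfolding connected_def strongly_connected_def
    by (simp add: reachable_mk_symmetric_eq[OF sym_arcs]) (simp add: dipole_def)
qed

lemma full_cycle_transpose: "full_cycle 2 (transpose 1 2)"
proof -
  have 12: "{1..2} = {1, 2::nat}"
    by auto
  have "orbit (transpose 1 2) 1 \<subseteq> {1, 2::nat}"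
  proof
    fix y :: nat
    assume "y \<in> orbit (transpose 1 2) 1"
    then show "y \<in> {1, 2}"
      by induction auto
  qed
  moreover have "2 \<in> orbit (transpose 1 2) (1::nat)"
    using orbit.base[of "transpose 1 2" "1::nat"] by simp
  moreover from this have "1 \<in> orbit (transpose 1 2) (1::nat)"
    using orbit.step[of 2 "transpose 1 2" "1::nat"] by simp
  ultimately show ?thesis
    unfolding full_cycle_def cyclic_on_def 12
    by (auto intro!: permutes_swap_id)
qed

lemma tangle_dipole:
  assumes "1 \<le> m" "m \<le> d" "even d"
  shows "tangle d (dipole m)"
proof -
  \<comment> \<open>For \<open>n = 2\<close> every full cycle is the transposition, so the
    \<open>d div 2\<close> permutations give \<open>d\<close> parallel edges, enough for
    \<open>m \<le> d\<close>.\<close>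
  define G where "G = perm_graph d 2 (\<lambda>_. transpose 1 2)"
  \<comment> \<open>The second component is the tail of the forward arc, hence the same for both
    arcs of an edge.\<close>
  define g :: "nat \<Rightarrow> lab \<times> nat" where "g a = (lab_of (dipole m) a, if even (a div 2) then 1 else 2)" for a
  have g: "g a = ((if even a then Fwd else Bwd) (a div 4 + 1), if even (a div 2) then 1 else 2)" for a
    by (simp add: g_def dipole_def)
  have "G \<in> model_H 2 d"
    using full_cycle_transpose by (auto simp: model_H_def G_def)
  moreover have "occurs_in (dipole m) G"
    unfolding occurs_in_def
  proof (intro exI[of _ "\<lambda>v. v"] exI[of _ g] conjI ballI)
    show "(\<lambda>v. v) ` V (dipole m) \<subseteq> V G"
      by (auto simp: dipole_def G_def perm_graph_def)
    show "inj_on g (E (dipole m))"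
    proof (rule inj_onI)
      fix a b assume "g a = g b"
      \<comment> \<open>Parity, \<open>a div 4\<close> and the bit between them determine
        \<open>a\<close>.\<close>
      then have "a mod 2 = b mod 2" "a div 2 div 2 = b div 2 div 2" "a div 2 mod 2 = b div 2 mod 2"
        by (auto simp: g mod_2_eq_odd split: if_splits simp flip: div_mult2_eq)
      then show "a = b"
        by (metis mult_div_mod_eq)
    qed
    have arcG: "g e \<in> perm_arcs d 2" if "e < 2 * m" for e
    proof -
      \<comment> \<open>Here \<open>e < 2 * d\<close>, and \<open>2 * d\<close> is a multiple of 4
        as \<open>d\<close> is even.\<close>
      have "e div 4 + 1 \<in> {1..d div 2}"
        using that assms by (auto elim!: evenE)
      then show ?thesis
        by (auto simp: g perm_arcs_def)
    qed
    then show "g ` E (dipole m) \<subseteq> E G"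
      by (auto simp: dipole_def G_def perm_graph_def)
    fix e assume "e \<in> E (dipole m)"
    then have e: "e < 2 * m"
      by (simp add: dipole_def)
    show "lab_of G (g e) = lab_of (dipole m) e"
      by (simp add: G_def perm_graph_def g_def)
    show "src G (g e) = src (dipole m) e" "trg G (g e) = trg (dipole m) e"
      by (auto simp: G_def perm_graph_def g dipole_def dipole_tail_def)
    have quarter: "a div 4 = a div 2 div 2" for a :: nat
      by (simp flip: div_mult2_eq)
    have "rev_arc (dipole m) e div 2 = e div 2" "even (rev_arc (dipole m) e) = odd e"
      using e by (auto simp: dipole_def elim!: oddE)
    then have "g (rev_arc (dipole m) e) = (inv_lab (fst (g e)), snd (g e))"
      by (simp add: g quarter)
    then show "rev_arc G (g e) = g (rev_arc (dipole m) e)"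
      using arcG[OF e] by (simp add: G_def perm_graph_def)
  qed simp
  ultimately show ?thesis
    using labelled_graph_dipole connected_dipole assms unfolding tangle_def by blast
qed

text \<open>Of the two arcs of each edge exactly one leaves \<open>v\<close>; \<open>h\<close>
  selects it.\<close>

lemma card_dipole_tail_eq:
  assumes "v \<in> {1, 2}"
  shows "card {a. a < 2 * m \<and> dipole_tail a = v} = m"
proof -
  define h where "h t = (if dipole_tail (2 * t) = v then 2 * t else 2 * t + 1)" for t
  have half: "h t div 2 = t" for t
    by (simp add: h_def)
  have h_eq: "h (a div 2) = a" if "dipole_tail a = v" for a
  proof (cases "even a")
    case True
    then have "2 * (a div 2) = a"
      by simp
    with that show ?thesis
      by (simp add: h_def)
  next
    case False
    then obtain b where b: "a = 2 * b + 1"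
      by (rule oddE)
    with that have "dipole_tail (2 * b) \<noteq> v"
      by (simp add: dipole_tail_def split: if_splits)
    then show ?thesis
      by (simp add: h_def b)
  qed
  have "a \<in> h ` {..<m}" if "a < 2 * m" "dipole_tail a = v" for a
    using h_eq[OF that(2)] that(1) by (intro image_eqI[of _ _ "a div 2"]) simp_all
  moreover have "dipole_tail (h t) = v" "h t < 2 * m" if "t < m" for t
    using assms that by (auto simp: h_def dipole_tail_def)
  ultimately have "{a. a < 2 * m \<and> dipole_tail a = v} = h ` {..<m}"
    by blast
  moreover have "inj_on h {..<m}"
    using half by (metis inj_onI)
  ultimately show ?thesis
    by (simp add: card_image)
qed

text \<open>Every arc has \<open>m - 1\<close> continuations, so the constant function 1 is an
  eigenfunction.\<close>

lemma lambda_irr_dipole_ge: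
  assumes "m \<ge> 1"
  shows "lambda_irr (dipole m) \<ge> real m - 1"
proof -
  let ?T = "dipole m"
  interpret fin_bidirected_digraph "dgraph ?T" "rev_arc ?T"
    using labelled_graph_dipole by (rule fin_bidirected_digraph_if_labelled_graph)
  have "0 \<in> E ?T"
    using assms by (simp add: dipole_def)
  have "card (nb_succ (E ?T) e) + 1 = m" if e: "e \<in> E ?T" for e
  proof -
    have "trg ?T e \<in> {1, 2}"
      by (simp add: dipole_def dipole_tail_def)
    then have "card {a. a < 2 * m \<and> dipole_tail a = trg ?T e} = m"
      by (rule card_dipole_tail_eq)
    then have "outdeg (E ?T) (trg ?T e) = m"
      unfolding outdeg_def by (simp add: dipole_def)
    moreover have "rev_arc ?T ` E ?T \<subseteq> E ?T"
      by auto
    ultimately show ?thesis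
      using card_nb_succ[OF subset_refl _ e] by simp
  qed
  then have "of_nat (card (nb_succ (E ?T) e)) = (of_nat m - 1 :: complex)" if "e \<in> E ?T" for e
    using that by (metis add_diff_cancel_right' of_nat_1 of_nat_add)
  then have "nb_eigenfunction (E ?T) (\<lambda>_. 1) (of_nat m - 1)"
    using \<open>0 \<in> E ?T\<close> by (auto simp: nb_eigenfunction_def)
  then have "norm (of_nat m - 1 :: complex) \<le> lambda_irr ?T"
    using \<open>0 \<in> E ?T\<close> eigenvalue_adj_mat_irr_iff[OF labelled_graph_dipole]
    by (intro norm_eigenvalue_le_lambda_irr[OF labelled_graph_dipole]) blast+
  moreover have "norm (of_nat m - 1 :: complex) = real m - 1"
    using assms by (metis abs_of_nonneg diff_ge_0_iff_ge norm_of_real of_nat_1 of_nat_le_iff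
        of_real_1 of_real_diff of_real_of_nat_eq)
  ultimately show ?thesis
    by simp
qed

lemma graph_order_dipole: "graph_order (dipole m) = int m - 2"
proof -
  have "2 * card (edges (dipole m)) = 2 * m"
    using card_arcs_eq_twice_card_edges[OF labelled_graph_dipole[of m]] by (simp add: dipole_def)
  then show ?thesis
    by (simp add: graph_order_def) (simp add: dipole_def)
qed

section \<open>The minimal order\<close>

theorem theorem6p10:
  fixes d :: nat
  assumes "d \<ge> 4" and "even d"
  shows "(\<exists>T \<in> supercritical_tangles d. graph_order T = \<lceil>sqrt (real d - 1)\<rceil> - 1) \<and>
         (\<forall>T \<in> supercritical_tangles d. graph_order T \<ge> \<lceil>sqrt (real d - 1)\<rceil> - 1)"
proof (intro conjI ballI)
  define s where "s = sqrt (real d - 1)"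
  have s: "s > 0"
    using assms by (simp add: s_def)
  \<comment> \<open>With this choice the order \<open>m - 2\<close> is the target value, and the
    eigenvalue \<open>m - 1\<close> is \<open>s\<close> rounded up.\<close>
  define m where "m = nat \<lceil>s\<rceil> + 1"
  have m: "int m = \<lceil>s\<rceil> + 1"
    using s by (simp add: m_def)
  \<comment> \<open>This leads to \<open>m \<le> d\<close>, so that \<open>m\<close> parallel edges
    fit into the model.\<close>
  have "real d - 1 \<le> (real d - 1)\<^sup>2"
    using assms by (intro self_le_power) auto
  then have "s \<le> real d - 1"
    using assms unfolding s_def by (intro real_le_lsqrt) auto
  then have "\<lceil>s\<rceil> \<le> int d - 1"
    by linarith
  then have "m \<le> d"
    using m by linarith
  then have "tangle d (dipole m)"
    using assms by (intro tangle_dipole) (auto simp: m_def)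
  moreover have "s \<le> real m - 1"
    using m by linarith
  then have "supercritical d (dipole m)"
    using lambda_irr_dipole_ge[of m] unfolding supercritical_def s_def[symmetric] by (simp add: m_def)
  ultimately show "\<exists>T \<in> supercritical_tangles d. graph_order T = \<lceil>sqrt (real d - 1)\<rceil> - 1"
    using m unfolding supercritical_tangles_def s_def[symmetric]
    by (auto simp: graph_order_dipole intro!: exI[of _ "dipole m"])
  fix T assume "T \<in> supercritical_tangles d"
  then have T: "tangle d T" "s \<le> lambda_irr T"
    by (auto simp: supercritical_tangles_def supercritical_def s_def)
  \<comment> \<open>Positivity of \<open>s\<close> passes to \<open>lambda_irr T\<close>;
    integrality of the order then allows rounding \<open>s\<close> up.\<close>
  then have "s \<le> of_int (graph_order T + 1)"
    using lambda_irr_le_order[OF T(1)] s by linarith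
  then show "\<lceil>sqrt (real d - 1)\<rceil> - 1 \<le> graph_order T"
    unfolding s_def[symmetric] by (simp add: ceiling_le_iff) linarith
qed

end
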